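(* Consider a MISO system ($p=1$) with data generated, partitioned and corrupted by noise as described in the context (in particular $l_{\mathrm p}=l_{\mathrm o}$ and the noise is bounded by $\delta$). Assume $$\delta<\frac{\sigma_{\min}(\widehat H)}{2l_{\mathrm h}}.$$ Let $u_{\mathrm f}\in\mathbb R^{ml_{\mathrm f}}$ and put $\overline\Delta_g(u_{\mathrm f}):=\bar g(u_{\mathrm f})-\hat g(u_{\mathrm f})$, $\overline\Delta_{y_{\mathrm f}}(u_{\mathrm f}):=\bar y_{\mathrm f}(u_{\mathrm f})-\hat y_{\mathrm f}(u_{\mathrm f})$. Then $$\|\overline\Delta_g(u_{\mathrm f})\|\le \mathcal C(u_{\mathrm f})\,\delta,\qquad \mathcal C(u_{\mathrm f}):=2\sigma_{\min}(\widehat H)^{-1}\bigl(\sqrt{l_{\mathrm p}}+l_{\mathrm h}\|\hat g(u_{\mathrm f})\|\bigr),$$ and $$\|\overline\Delta_{y_{\mathrm f}}(u_{\mathrm f})\|\le \mathcal C(u_{\mathrm f})\|\widehat Y_{\mathrm f}\|\,\delta+l_{\mathrm h}\bigl(\|\hat g(u_{\mathrm f})\|+\mathcal C(u_{\mathrm f})\bigr)\delta .$$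
   Context: Norms: $\|\cdot\|$ is the Euclidean norm of a vector and the spectral norm of a matrix; $\|M\|_{\max}=\max_{i,j}|m_{ij}|$; $\sigma_{\min}$ is the smallest singular value; $\dagger$ is the Moore–Penrose pseudoinverse. For a sequence $v$, $v_{[a,b]}=\{v_a,\dots,v_b\}$ and $\mathrm{col}(v_{[a,b]})$ is the stacked column vector. System: $x_{t+1}=Ax_t+Bu_t$, $y_t=Cx_t+Du_t$ with $u_t\in\mathbb R^m$, $y_t\in\mathbb R^p$, $x_t\in\mathbb R^{n_x}$, controllable and observable (minimal realization); MISO means $p=1$. The observability index $l_{\mathrm o}$ is the smallest positive integer $l$ such that $[C^\top\ (CA)^\top\ \cdots\ (CA^{l-1})^\top]^\top$ has full column rank. Page matrices: for a sequence $v_{[1,T]}$ and $l_{\mathrm h}=\lfloor T/L\rfloor$, $\mathcal P_L(v_{[1,T]})$ is the matrix with $l_{\mathrm h}$ columns whose $j$-th column is $\mathrm{col}(v_{[(j-1)L+1,\,jL]})$ (and similarly for sequences starting at another index). The sequence $u_{[1,T]}$ is $L$-Page exciting of order $d$ if the matrix obtained by stacking vertically $\mathcal P_L(u_{[1,T-(d-1)L]})$, $\mathcal P_L(u_{[L+1,T-(d-2)L]})$, ..., $\mathcal P_L(u_{[L(d-1)+1,T]})$ has full row rank. Historical data: $L>l_{\mathrm o}$; $x_1=0$; the blocks $u_{[1,L]},u_{[L+1,2L]},\dots,u_{[4L^2+1,4L^2+L]}$ are i.i.d. with law $\mathcal Q$ on $\mathbb R^{mL}$, where $\mathcal Q$ gives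 probability $0$ to every subspace $V\subsetneqq\mathbb R^{mL}$; $T\ge 4L^2+L$ and $u_{[1,T]}$ is $L$-Page exciting of order $n_x+1$. $y_{[1,T]}$ is the resulting noiseless output and $\hat y_{[1,T]}$ the noisy measurement. Partition: $l_{\mathrm p}=l_{\mathrm o}$, $l_{\mathrm f}=L-l_{\mathrm p}$. $U_{\mathrm p}$ and $U_{\mathrm f}$ are the first $ml_{\mathrm p}$ and last $ml_{\mathrm f}$ rows of $\mathcal P_L(u_{[1,T]})$; $Y_{\mathrm p},Y_{\mathrm f}$ (resp. $\widehat Y_{\mathrm p},\widehat Y_{\mathrm f}$) are the first $pl_{\mathrm p}$ and last $pl_{\mathrm f}$ rows of $\mathcal P_L(y_{[1,T]})$ (resp. $\mathcal P_L(\hat y_{[1,T]})$). A recent trajectory $(u^r_{[1,l_{\mathrm p}]},y^r_{[1,l_{\mathrm p}]})$ of the system is given, $u_{\mathrm p}=\mathrm{col}(u^r_{[1,l_{\mathrm p}]})$, $y_{\mathrm p}=\mathrm{col}(y^r_{[1,l_{\mathrm p}]})$, and $\hat y_{\mathrm p}$ is the noisy measurement of $y_{\mathrm p}$. Noise bound: for a known constant $\delta>0$, $\max\{\|\widehat Y_{\mathrm p}-Y_{\mathrm p}\|_{\max},\|\widehat Y_{\mathrm f}-Y_{\mathrm f}\|_{\max},\|\hat y_{\mathrm p}-y_{\mathrm p}\|_\infty\}\le\delta$. Predictor: $\widehat H=[U_{\mathrm p}^\top\ \widehat Y_{\mathrm p}^\top\ U_{\mathrm f}^\top]^\top$, $\hat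 b(u_{\mathrm f})=[u_{\mathrm p}^\top\ \hat y_{\mathrm p}^\top\ u_{\mathrm f}^\top]^\top$, $\hat g(u_{\mathrm f})=\widehat H^\dagger\hat b(u_{\mathrm f})$, $\hat y_{\mathrm f}(u_{\mathrm f})=\widehat Y_{\mathrm f}\hat g(u_{\mathrm f})$. The noiseless counterparts are $\overline H=[U_{\mathrm p}^\top\ Y_{\mathrm p}^\top\ U_{\mathrm f}^\top]^\top$, $\bar b(u_{\mathrm f})=[u_{\mathrm p}^\top\ y_{\mathrm p}^\top\ u_{\mathrm f}^\top]^\top$, $\bar g(u_{\mathrm f})=\overline H^\dagger\bar b(u_{\mathrm f})$, $\bar y_{\mathrm f}(u_{\mathrm f})=Y_{\mathrm f}\bar g(u_{\mathrm f})$.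
   Formalization: The second inequality is false for large δ (the right side does not scale with the data); it is proved with C(u_f)δ in place of the last C(u_f) for all δ, and as printed for δ ≤ 1. The state dimension is assumed positive. *)

theory Defs
  imports
    "HOL-Probability.Probability"
    "Jordan_Normal_Form.Char_Poly"
    "Jordan_Normal_Form.DL_Rank"
begin

type_synonym rvec = "real Matrix.vec"
type_synonym rmat = "real Matrix.mat"

subsection \<open>Norms, singular values, pseudoinverse\<close>

definition enorm :: "rvec \<Rightarrow> real" where
  "enorm v = sqrt (scalar_prod v v)"

definition vec_max_norm :: "rvec \<Rightarrow> real" where
  "vec_max_norm v = Max ((\<lambda>i. \<bar>vec_index v i\<bar>) ` {..<dim_vec v})"

definition mat_max_norm :: "rmat \<Rightarrow> real" where
  "mat_max_norm M = Max (abs ` elements_mat M)"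

definition spectral_norm :: "rmat \<Rightarrow> real" where
  "spectral_norm M = (SUP v\<in>{v \<in> carrier_vec (dim_col M). enorm v \<le> 1}. enorm (M *\<^sub>v v))"

text \<open>An r-by-c matrix has min(r,c) singular values: the square roots of the eigenvalues of the
  smaller of its two Gram matrices.\<close>

definition singular_values :: "rmat \<Rightarrow> real set" where
  "singular_values M =
     sqrt ` {k. eigenvalue (if dim_row M \<le> dim_col M
                            then M * transpose_mat M else transpose_mat M * M) k}"

definition sigma_min :: "rmat \<Rightarrow> real" where
  "sigma_min M = Min (singular_values M)"

definition pinv :: "rmat \<Rightarrow> rmat" where
  "pinv M = (THE X. X \<in> carrier_mat (dim_col M) (dim_row M)
     \<and> M * X * M = M \<and> X * M * X = X
     \<and> transpose_mat (M * X) = M * X \<and> transpose_mat (X * M) = X * M)"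

definition full_row_rank :: "rmat \<Rightarrow> bool" where
  "full_row_rank M \<longleftrightarrow> vec_space.rank (dim_row M) M = dim_row M"

definition full_col_rank :: "rmat \<Rightarrow> bool" where
  "full_col_rank M \<longleftrightarrow> vec_space.rank (dim_row M) M = dim_col M"

definition vstack :: "nat \<Rightarrow> rmat list \<Rightarrow> rmat" where
  "vstack nc Ms = foldr append_rows Ms (0\<^sub>m 0 nc)"

definition first_rows :: "nat \<Rightarrow> rmat \<Rightarrow> rmat" where
  "first_rows k M = mat_of_rows (dim_col M) (take k (rows M))"

definition last_rows :: "nat \<Rightarrow> rmat \<Rightarrow> rmat" where
  "last_rows k M = mat_of_rows (dim_col M) (drop (dim_row M - k) (rows M))"

subsection \<open>Linear time-invariant systems\<close>

definition lti_trajectory ::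
  "rmat \<Rightarrow> rmat \<Rightarrow> rmat \<Rightarrow> rmat \<Rightarrow> nat \<Rightarrow> (nat \<Rightarrow> rvec) \<Rightarrow> (nat \<Rightarrow> rvec) \<Rightarrow> (nat \<Rightarrow> rvec) \<Rightarrow> bool" where
  "lti_trajectory A B C D N x u y \<longleftrightarrow>
     (\<forall>t\<in>{1..N}. x t \<in> carrier_vec (dim_row A) \<and> u t \<in> carrier_vec (dim_col B)
        \<and> x (t + 1) = A *\<^sub>v x t + B *\<^sub>v u t \<and> y t = C *\<^sub>v x t + D *\<^sub>v u t)"

definition controllable :: "rmat \<Rightarrow> rmat \<Rightarrow> rmat \<Rightarrow> rmat \<Rightarrow> bool" where
  "controllable A B C D \<longleftrightarrow>
     (\<forall>\<xi>\<in>carrier_vec (dim_row A). \<forall>\<eta>\<in>carrier_vec (dim_row A).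
        \<exists>N x u y. lti_trajectory A B C D N x u y \<and> x 1 = \<xi> \<and> x (N + 1) = \<eta>)"

definition observable :: "rmat \<Rightarrow> rmat \<Rightarrow> rmat \<Rightarrow> rmat \<Rightarrow> bool" where
  "observable A B C D \<longleftrightarrow>
     (\<forall>x x' u y. (\<forall>N. lti_trajectory A B C D N x u y) \<and> (\<forall>N. lti_trajectory A B C D N x' u y)
        \<longrightarrow> x 1 = x' 1)"

definition observability_matrix :: "rmat \<Rightarrow> rmat \<Rightarrow> nat \<Rightarrow> rmat" where
  "observability_matrix A C l = vstack (dim_col A) (map (\<lambda>i. C * (A ^\<^sub>m i)) [0..<l])"

definition observability_index :: "rmat \<Rightarrow> rmat \<Rightarrow> nat" where
  "observability_index A C = (LEAST l. 0 < l \<and> full_col_rank (observability_matrix A C l))"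

subsection \<open>Page matrices\<close>

text \<open>Throughout, \<open>d\<close> is the dimension of the samples of the sequence and \<open>{a..b}\<close> the time window.\<close>

definition col_seq :: "nat \<Rightarrow> (nat \<Rightarrow> rvec) \<Rightarrow> nat \<Rightarrow> nat \<Rightarrow> rvec" where
  "col_seq d v a b = Matrix.vec (d * (b + 1 - a)) (\<lambda>i. vec_index (v (a + i div d)) (i mod d))"

definition page_matrix :: "nat \<Rightarrow> nat \<Rightarrow> (nat \<Rightarrow> rvec) \<Rightarrow> nat \<Rightarrow> nat \<Rightarrow> rmat" where
  "page_matrix d L v a b =
     mat_of_cols (d * L) (map (\<lambda>j. col_seq d v (a + j * L) (a + j * L + L - 1))
                              [0..<(b + 1 - a) div L])"

text \<open>If \<open>T < (k - 1) * L\<close>, all stacked matrices have zero columns (truncated subtraction).\<close>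

definition page_exciting :: "nat \<Rightarrow> nat \<Rightarrow> nat \<Rightarrow> (nat \<Rightarrow> rvec) \<Rightarrow> nat \<Rightarrow> bool" where
  "page_exciting d L T u k \<longleftrightarrow>
     full_row_rank (vstack ((T - (k - 1) * L) div L)
       (map (\<lambda>i. page_matrix d L u (i * L + 1) (T - (k - 1 - i) * L)) [0..<k]))"

subsection \<open>Random input blocks\<close>

text \<open>Laws on \<open>\<real>\<^sup>d\<close> are measures on the product space \<open>PiM {..<d} (\<lambda>_. borel)\<close>; \<open>coords\<close> and
  \<open>Matrix.vec d\<close> translate between its points and vectors of dimension \<open>d\<close>.\<close>

definition coords :: "rvec \<Rightarrow> nat \<Rightarrow> real" where
  "coords v = restrict (vec_index v) {..<dim_vec v}"

definition null_on_proper_subspaces :: "nat \<Rightarrow> (nat \<Rightarrow> real) measure \<Rightarrow> bool" where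
  "null_on_proper_subspaces d Q \<longleftrightarrow>
     (\<forall>V. VectorSpace.subspace class_ring V (module_vec TYPE(real) d) \<and> V \<noteq> carrier_vec d
        \<longrightarrow> {z \<in> space Q. Matrix.vec d z \<in> V} \<in> null_sets Q)"

definition input_block :: "nat \<Rightarrow> nat \<Rightarrow> (nat \<Rightarrow> rvec) \<Rightarrow> nat \<Rightarrow> nat \<Rightarrow> real" where
  "input_block m L u k = coords (col_seq m u (k * L + 1) (k * L + L))"

definition iid_input_blocks ::
  "'w measure \<Rightarrow> (nat \<Rightarrow> real) measure \<Rightarrow> nat \<Rightarrow> nat \<Rightarrow> nat \<Rightarrow> ('w \<Rightarrow> nat \<Rightarrow> rvec) \<Rightarrow> bool" where
  "iid_input_blocks M Q m L N u \<longleftrightarrow>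
     prob_space.indep_vars M (\<lambda>_. Q) (\<lambda>k \<omega>. input_block m L (u \<omega>) k) {..<N}
     \<and> (\<forall>k<N. distr M Q (\<lambda>\<omega>. input_block m L (u \<omega>) k) = Q)"

end

theory Submission
  imports Defs "Jordan_Normal_Form.Spectral_Radius"
begin

unbundle no inner_syntax
unbundle no vec_syntax

text \<open>
  The noisy and the noiseless coefficient vectors are the minimum-norm solutions of \<open>Hh g = bh\<close> and
  \<open>Hb g = bb\<close>. So the statement is a perturbation bound for minimum-norm solutions, with the noisy
  data as reference point.

  Page excitation and the length of the experiment make the data matrices wide. Therefore
  \<open>s = sigma_min Hh > 0\<close> means
  \<open>s \<parallel>w\<parallel> \<le> \<parallel>Hh\<^sup>T w\<parallel>\<close> for all \<open>w\<close> (\<open>sigma_min_mult_le_enorm_transpose\<close>). The noise touches only the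
  \<open>l\<^sub>p\<close> rows of past outputs, hence \<open>Hb - Hh\<close> has operator norm at most
  \<open>c = sqrt (l\<^sub>p l\<^sub>h) \<delta> \<le> l\<^sub>h \<delta> < s / 2\<close>. It follows that \<open>Hb\<^sup>T\<close> is bounded below by \<open>s / 2\<close>. Both matrices
  therefore have full row rank, both linear systems are solved exactly, and both solutions lie in the
  row space of their matrix (\<open>pinv_min_norm_solution\<close>).

  The row spaces of the two matrices may differ, so \<open>Hb (gb - gh) = (bb - bh) - (Hb - Hh) gh\<close> alone does
  not bound \<open>gb - gh\<close>. It bounds only the component in the row space of \<open>Hb\<close>, by
  \<open>2 / s (sqrt l\<^sub>p \<delta> + c \<parallel>gh\<parallel>)\<close>. The orthogonal component in the kernel of \<open>Hb\<close> is at most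
  \<open>c \<parallel>gh\<parallel> / s\<close>, because \<open>Hh\<close> is small on that kernel (\<open>min_norm_solution_perturbation\<close>). By Pythagoras
  the sum of the two squares bounds \<open>\<parallel>gb - gh\<parallel>\<^sup>2\<close>. The length of the experiment gives \<open>l\<^sub>h \<ge> 4 L + 1\<close>,
  so \<open>sqrt (l\<^sub>p l\<^sub>h)\<close> is less than half of \<open>l\<^sub>h\<close>, and the difference pays for the kernel component
  (\<open>gain_inequality\<close>).

  The output bound is the triangle inequality for
  \<open>yfb - yfh = Yfh (gb - gh) + (Yf - Yfh) gb\<close>, with \<open>\<parallel>gb\<parallel> \<le> \<parallel>gh\<parallel> + gain \<delta>\<close>.
\<close>

section \<open>The Euclidean norm\<close>

lemma enorm_eq_L2_set: "enorm v = L2_set (\<lambda>i. v $ i) {..<dim_vec v}"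
  by (simp add: enorm_def L2_set_def scalar_prod_def power2_eq_square atLeast0LessThan)

lemma enorm_nonneg [simp]: "0 \<le> enorm v"
  by (simp add: enorm_eq_L2_set)

lemma enorm_sq: "(enorm v)\<^sup>2 = v \<bullet> v"
  by (simp add: enorm_def scalar_prod_def sum_nonneg)

lemma enorm_zero [simp]: "enorm (0\<^sub>v k) = 0"
  by (simp add: enorm_eq_L2_set L2_set_eq_0_iff)

lemma enorm_smult: "enorm (c \<cdot>\<^sub>v v) = \<bar>c\<bar> * enorm v"
  by (simp add: enorm_def real_sqrt_mult scalar_prod_smult_left scalar_prod_smult_right
      flip: mult.assoc)

lemma enorm_pos: "v \<in> carrier_vec k \<Longrightarrow> v \<noteq> 0\<^sub>v k \<Longrightarrow> 0 < enorm v"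
  by (auto simp: enorm_eq_L2_set order.strict_iff_order L2_set_eq_0_iff intro!: eq_vecI)

lemma scalar_prod_le_enorm:
  assumes "v \<in> carrier_vec k" "w \<in> carrier_vec k"
  shows "v \<bullet> w \<le> enorm v * enorm w"
proof -
  have "v \<bullet> w \<le> (\<Sum>i<k. \<bar>v $ i\<bar> * \<bar>w $ i\<bar>)"
    using assms by (auto simp: scalar_prod_def atLeast0LessThan simp flip: abs_mult intro!: sum_mono)
  also have "\<dots> \<le> enorm v * enorm w"
    using L2_set_mult_ineq assms by (auto simp: enorm_eq_L2_set)
  finally show ?thesis .
qed

lemma enorm_add_le:
  assumes "v \<in> carrier_vec k" "w \<in> carrier_vec k"
  shows "enorm (v + w) \<le> enorm v + enorm w"
proof -
  have "enorm (v + w) = L2_set (\<lambda>i. v $ i + w $ i) {..<k}"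
    using assms by (auto simp: enorm_eq_L2_set intro!: L2_set_cong)
  also have "\<dots> \<le> enorm v + enorm w"
    using L2_set_triangle_ineq[of "\<lambda>i. v $ i" "\<lambda>i. w $ i" "{..<k}"] assms
    by (simp add: enorm_eq_L2_set)
  finally show ?thesis .
qed

lemma enorm_diff_le:
  assumes "v \<in> carrier_vec k" "w \<in> carrier_vec k"
  shows "enorm (v - w) \<le> enorm v + enorm w"
proof -
  have "enorm (- w) = enorm w"
    by (simp add: enorm_eq_L2_set L2_set_def)
  moreover have "v - w = v + - w"
    using assms by (auto intro!: eq_vecI)
  ultimately show ?thesis
    using enorm_add_le[of v k "- w"] assms by simp
qed

lemma enorm_append_sq:
  assumes "v \<in> carrier_vec k" "w \<in> carrier_vec l"
  shows "(enorm (v @\<^sub>v w))\<^sup>2 = (enorm v)\<^sup>2 + (enorm w)\<^sup>2"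
  using assms by (simp add: enorm_sq scalar_prod_append)

lemma enorm_append_zero:
  assumes "v \<in> carrier_vec k"
  shows "enorm (0\<^sub>v j @\<^sub>v v @\<^sub>v 0\<^sub>v l) = enorm v"
  by (rule power2_eq_imp_eq)
    (use assms enorm_append_sq[of "0\<^sub>v j" j "v @\<^sub>v 0\<^sub>v l" "k + l"] enorm_append_sq[of v k "0\<^sub>v l" l] in auto)

lemma enorm_le_entries:
  assumes "v \<in> carrier_vec k" "\<And>i. i < k \<Longrightarrow> \<bar>v $ i\<bar> \<le> \<epsilon>" "0 \<le> \<epsilon>"
  shows "enorm v \<le> sqrt (real k) * \<epsilon>"
proof -
  have "(\<Sum>i<k. (v $ i)\<^sup>2) \<le> (\<Sum>i<k. \<epsilon>\<^sup>2)"
    by (intro sum_mono) (metis assms(2) abs_ge_zero lessThan_iff power2_abs power_mono)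
  then have "sqrt (\<Sum>i<k. (v $ i)\<^sup>2) \<le> sqrt (real k * \<epsilon>\<^sup>2)"
    by simp
  then show ?thesis
    using assms by (simp add: enorm_eq_L2_set L2_set_def real_sqrt_mult)
qed

section \<open>Bounds on matrix-vector products\<close>

text \<open>The constant bounds the Frobenius norm of \<open>M\<close>: Cauchy--Schwarz for every row, then the sum over the rows.\<close>

lemma enorm_mult_mat_vec_le_entries:
  assumes M: "M \<in> carrier_mat k l" and v: "v \<in> carrier_vec l"
    and ent: "\<And>i j. i < k \<Longrightarrow> j < l \<Longrightarrow> \<bar>M $$ (i, j)\<bar> \<le> \<epsilon>" and "0 \<le> \<epsilon>"
  shows "enorm (M *\<^sub>v v) \<le> sqrt (real k * real l) * \<epsilon> * enorm v"
proof -
  have "\<bar>(M *\<^sub>v v) $ i\<bar> \<le> sqrt (real l) * \<epsilon> * enorm v" if "i < k" for i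
  proof -
    have r: "row M i \<in> carrier_vec l" and r': "- row M i \<in> carrier_vec l"
      using M that by auto
    have "enorm (row M i) \<le> sqrt (real l) * \<epsilon>"
      using M that ent \<open>0 \<le> \<epsilon>\<close> by (intro enorm_le_entries[OF r]) auto
    then have "enorm (row M i) * enorm v \<le> sqrt (real l) * \<epsilon> * enorm v"
      by (simp add: mult_right_mono)
    moreover have "enorm (- row M i) = enorm (row M i)"
      by (simp add: enorm_eq_L2_set L2_set_def)
    moreover have "- row M i \<bullet> v = - (row M i \<bullet> v)"
      using r v M by (intro scalar_prod_uminus_left) auto
    ultimately show ?thesis
      using scalar_prod_le_enorm[OF r v] scalar_prod_le_enorm[OF r' v] M that by simp
  qed
  then have "enorm (M *\<^sub>v v) \<le> sqrt (real k) * (sqrt (real l) * \<epsilon> * enorm v)"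
    using M v \<open>0 \<le> \<epsilon>\<close> by (intro enorm_le_entries) auto
  then show ?thesis
    by (simp add: real_sqrt_mult mult_ac)
qed

text \<open>Boundedness is what makes the supremum in \<open>spectral_norm\<close> an honest least upper bound, and it
  supplies the constants in the proof that the minimal Rayleigh quotient is an eigenvalue.\<close>

lemma mult_mat_vec_bounded:
  fixes M :: rmat
  assumes M: "M \<in> carrier_mat k l"
  obtains c where "0 < c" "\<And>v. v \<in> carrier_vec l \<Longrightarrow> enorm (M *\<^sub>v v) \<le> c * enorm v"
proof -
  define \<epsilon> where "\<epsilon> = (\<Sum>i<k. \<Sum>j<l. \<bar>M $$ (i, j)\<bar>)"
  have "\<bar>M $$ (i, j)\<bar> \<le> \<epsilon>" if "i < k" "j < l" for i j
  proof -
    have "\<bar>M $$ (i, j)\<bar> \<le> (\<Sum>j<l. \<bar>M $$ (i, j)\<bar>)"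
      using that by (intro member_le_sum) auto
    also have "\<dots> \<le> \<epsilon>"
      unfolding \<epsilon>_def using that by (intro member_le_sum[where f = "\<lambda>i. \<Sum>j<l. \<bar>M $$ (i, j)\<bar>"]) (auto intro: sum_nonneg)
    finally show ?thesis .
  qed
  moreover have "0 \<le> \<epsilon>"
    unfolding \<epsilon>_def by (intro sum_nonneg) auto
  ultimately have *: "enorm (M *\<^sub>v v) \<le> sqrt (real k * real l) * \<epsilon> * enorm v" if "v \<in> carrier_vec l" for v
    using enorm_mult_mat_vec_le_entries[OF M that] by blast
  have "enorm (M *\<^sub>v v) \<le> (sqrt (real k * real l) * \<epsilon> + 1) * enorm v" if "v \<in> carrier_vec l" for v
    using *[OF that] by (simp add: distrib_right add_increasing2)
  moreover have "0 < sqrt (real k * real l) * \<epsilon> + 1"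
    using \<open>0 \<le> \<epsilon>\<close> by (simp add: add_nonneg_pos)
  ultimately show thesis
    using that by blast
qed

text \<open>A matrix and its transpose have the same operator norm. With \<open>t = M\<^sup>T w\<close> this follows from
  \<open>\<parallel>t\<parallel>\<^sup>2 = w \<bullet> M t \<le> \<parallel>w\<parallel> c \<parallel>t\<parallel>\<close>.\<close>

lemma enorm_transpose_mult_le:
  assumes M: "M \<in> carrier_mat k l" and w: "w \<in> carrier_vec k"
    and bound: "\<And>v. v \<in> carrier_vec l \<Longrightarrow> enorm (M *\<^sub>v v) \<le> c * enorm v"
    and "0 \<le> c"
  shows "enorm (M\<^sup>T *\<^sub>v w) \<le> c * enorm w"
proof (cases "enorm (M\<^sup>T *\<^sub>v w) = 0")
  case True
  then show ?thesis
    using \<open>0 \<le> c\<close> by simp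
next
  case False
  let ?t = "M\<^sup>T *\<^sub>v w"
  have t: "?t \<in> carrier_vec l"
    using M w by auto
  have "(enorm ?t)\<^sup>2 = w \<bullet> (M *\<^sub>v ?t)"
    unfolding enorm_sq using transpose_vec_mult_scalar[OF M t w] M w t
    by (metis comm_scalar_prod mult_mat_vec_carrier)
  also have "\<dots> \<le> enorm w * (c * enorm ?t)"
    using scalar_prod_le_enorm[OF w, of "M *\<^sub>v ?t"] bound[OF t] M t
    by (meson enorm_nonneg mult_left_mono mult_mat_vec_carrier order.trans)
  finally have "enorm ?t * enorm ?t \<le> enorm ?t * (c * enorm w)"
    by (simp add: power2_eq_square mult_ac)
  then show ?thesis
    using False enorm_nonneg[of ?t] by (simp add: mult_le_cancel_left)
qed

lemma enorm_mult_le_spectral_norm_unit_ball: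
  assumes M: "M \<in> carrier_mat k l" and v: "v \<in> carrier_vec l" "enorm v \<le> 1"
  shows "enorm (M *\<^sub>v v) \<le> spectral_norm M"
  unfolding spectral_norm_def
proof (rule cSUP_upper)
  obtain c where c: "0 < c" "\<And>v. v \<in> carrier_vec l \<Longrightarrow> enorm (M *\<^sub>v v) \<le> c * enorm v"
    using mult_mat_vec_bounded[OF M] by blast
  show "bdd_above ((\<lambda>v. enorm (M *\<^sub>v v)) ` {v \<in> carrier_vec (dim_col M). enorm v \<le> 1})"
  proof (rule bdd_aboveI2)
    fix w assume "w \<in> {v \<in> carrier_vec (dim_col M). enorm v \<le> 1}"
    then have "enorm (M *\<^sub>v w) \<le> c * enorm w" "c * enorm w \<le> c * 1"
      using c M by (auto intro!: mult_left_mono)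
    then show "enorm (M *\<^sub>v w) \<le> c"
      by simp
  qed
qed (use M v in auto)

lemma spectral_norm_nonneg: "0 \<le> spectral_norm M"
  by (rule order.trans[OF enorm_nonneg enorm_mult_le_spectral_norm_unit_ball
        [of M "dim_row M" "dim_col M" "0\<^sub>v (dim_col M)"]]) simp_all

lemma enorm_mult_mat_vec_le_spectral_norm:
  assumes M: "M \<in> carrier_mat k l" and v: "v \<in> carrier_vec l"
  shows "enorm (M *\<^sub>v v) \<le> spectral_norm M * enorm v"
proof (cases "v = 0\<^sub>v l")
  case True
  have "M *\<^sub>v v = 0\<^sub>v k"
    using True M by auto
  then show ?thesis
    using True by simp
next
  case False
  then have pos: "0 < enorm v"
    using enorm_pos v by blast
  have "enorm (M *\<^sub>v ((1 / enorm v) \<cdot>\<^sub>v v)) \<le> spectral_norm M"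
    using v pos by (intro enorm_mult_le_spectral_norm_unit_ball[OF M]) (simp_all add: enorm_smult)
  then show ?thesis
    using pos by (simp add: mult_mat_vec[OF M v] enorm_smult divide_simps)
qed

section \<open>The smallest singular value\<close>

lemma inverse_of_injective_mat:
  fixes P :: rmat
  assumes P: "P \<in> carrier_mat k k"
    and inj: "\<And>v. v \<in> carrier_vec k \<Longrightarrow> P *\<^sub>v v = 0\<^sub>v k \<Longrightarrow> v = 0\<^sub>v k"
  obtains W where "W \<in> carrier_mat k k" "W * P = 1\<^sub>m k" "P * W = 1\<^sub>m k"
proof -
  have "det P \<noteq> 0"
    using det_0_iff_vec_prod_zero_field[OF P] inj by blast
  from det_non_zero_imp_unit[OF P this, of "()"] show thesis
    using that by (auto simp: Units_def ring_mat_simps)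
qed

text \<open>For a positive semidefinite \<open>P\<close> the form controls the image. Evaluating the form at
  \<open>v - t P v\<close> gives the quadratic polynomial \<open>v \<bullet> P v - 2 t \<parallel>P v\<parallel>\<^sup>2 + t\<^sup>2 (P v \<bullet> P (P v))\<close>, which is
  nonnegative. Its last coefficient is at most \<open>c \<parallel>P v\<parallel>\<^sup>2\<close>, and \<open>t = 1 / c\<close> minimises the
  resulting upper bound.\<close>

lemma psd_enorm_mult_le:
  assumes P: "P \<in> carrier_mat k k" and sym: "P\<^sup>T = P"
    and psd: "\<And>v. v \<in> carrier_vec k \<Longrightarrow> 0 \<le> v \<bullet> (P *\<^sub>v v)"
    and c: "0 < c" "\<And>v. v \<in> carrier_vec k \<Longrightarrow> enorm (P *\<^sub>v v) \<le> c * enorm v"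
    and v: "v \<in> carrier_vec k"
  shows "(enorm (P *\<^sub>v v))\<^sup>2 \<le> c * (v \<bullet> (P *\<^sub>v v))"
proof -
  define p where "p = P *\<^sub>v v"
  define t where "t = 1 / c"
  have p: "p \<in> carrier_vec k" and Pp: "P *\<^sub>v p \<in> carrier_vec k"
    using P v by (auto simp: p_def)
  have vPp: "v \<bullet> (P *\<^sub>v p) = p \<bullet> p"
    using transpose_vec_mult_scalar[OF P p v] by (simp add: sym p_def)
  have "p \<bullet> (P *\<^sub>v p) \<le> enorm p * enorm (P *\<^sub>v p)"
    by (rule scalar_prod_le_enorm[OF p Pp])
  also have "\<dots> \<le> enorm p * (c * enorm p)"
    by (intro mult_left_mono c p) auto
  also have "\<dots> = c * (p \<bullet> p)"
    by (simp add: power2_eq_square flip: enorm_sq)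
  finally have pPp: "p \<bullet> (P *\<^sub>v p) \<le> c * (p \<bullet> p)" .
  have "0 \<le> (v - t \<cdot>\<^sub>v p) \<bullet> (P *\<^sub>v (v - t \<cdot>\<^sub>v p))"
    by (rule psd) (use v p in auto)
  also have "P *\<^sub>v (v - t \<cdot>\<^sub>v p) = p - t \<cdot>\<^sub>v (P *\<^sub>v p)"
    using v p P by (simp add: mult_minus_distrib_mat_vec[OF P] mult_mat_vec[OF P] p_def)
  also have "(v - t \<cdot>\<^sub>v p) \<bullet> (p - t \<cdot>\<^sub>v (P *\<^sub>v p))
      = v \<bullet> p - 2 * t * (p \<bullet> p) + t\<^sup>2 * (p \<bullet> (P *\<^sub>v p))"
    using v p Pp vPp
    by (simp add: minus_scalar_prod_distrib[of _ k] scalar_prod_minus_distrib[of _ k]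
        power2_eq_square algebra_simps)
  also have "\<dots> \<le> v \<bullet> p - 2 * t * (p \<bullet> p) + t\<^sup>2 * (c * (p \<bullet> p))"
    using pPp by (simp add: mult_left_mono)
  also have "\<dots> = v \<bullet> p - (p \<bullet> p) / c"
    using c by (simp add: t_def power2_eq_square field_simps)
  finally show ?thesis
    using c by (simp add: enorm_sq p_def field_simps)
qed

text \<open>The eigenvalue is the infimum \<open>\<mu>\<close> of the Rayleigh quotient. That the infimum is an eigenvalue is
  seen without a compactness argument: otherwise the positive semidefinite matrix \<open>P = K - \<mu> I\<close> is
  invertible, so \<open>\<parallel>P v\<parallel>\<close> is bounded away from \<open>0\<close> on the unit sphere. By
  \<open>psd_enorm_mult_le\<close> the form \<open>v \<bullet> P v\<close> is then bounded away from \<open>0\<close> as well, and \<open>\<mu>\<close> would not be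
  the greatest lower bound.\<close>

lemma symmetric_rayleigh_eigenvalue:
  fixes K :: rmat
  assumes K: "K \<in> carrier_mat k k" and sym: "K\<^sup>T = K" and "0 < k"
  obtains \<mu> where "eigenvalue K \<mu>" "\<And>v. v \<in> carrier_vec k \<Longrightarrow> \<mu> * (v \<bullet> v) \<le> v \<bullet> (K *\<^sub>v v)"
proof -
  define S where "S = {v \<bullet> (K *\<^sub>v v) | v. v \<in> carrier_vec k \<and> enorm v = 1}"
  define \<mu> where "\<mu> = Inf S"
  define P where "P = K - \<mu> \<cdot>\<^sub>m 1\<^sub>m k"
  have P: "P \<in> carrier_mat k k"
    unfolding P_def using K by auto
  have "P\<^sup>T = P"
  proof (rule eq_matI)
    fix i j assume ij: "i < dim_row P" "j < dim_col P"
    then have "K\<^sup>T $$ (i, j) = K $$ (j, i)"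
      using K P by simp
    then show "P\<^sup>T $$ (i, j) = P $$ (i, j)"
      using ij P K by (simp add: P_def sym)
  qed (use P in auto)
  have Pv: "P *\<^sub>v v = K *\<^sub>v v - \<mu> \<cdot>\<^sub>v v" if "v \<in> carrier_vec k" for v
  proof -
    have "(\<mu> \<cdot>\<^sub>m 1\<^sub>m k) *\<^sub>v v = \<mu> \<cdot>\<^sub>v v"
      using that by (intro eq_vecI) auto
    then show ?thesis
      unfolding P_def using that K by (simp add: minus_mult_distrib_mat_vec[of _ k k])
  qed
  have vPv: "v \<bullet> (P *\<^sub>v v) = v \<bullet> (K *\<^sub>v v) - \<mu> * (v \<bullet> v)" if "v \<in> carrier_vec k" for v
    using that K by (simp add: Pv scalar_prod_minus_distrib[of _ k])
  have "unit_vec k 0 \<in> carrier_vec k" "enorm (unit_vec k 0 :: rvec) = 1"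
    using \<open>0 < k\<close> by (auto simp: enorm_def)
  then have ne: "S \<noteq> {}"
    unfolding S_def by blast
  obtain c where c: "0 < c" "\<And>v. v \<in> carrier_vec k \<Longrightarrow> enorm (K *\<^sub>v v) \<le> c * enorm v"
    using mult_mat_vec_bounded[OF K] by blast
  have bdd: "bdd_below S"
  proof (rule bdd_belowI)
    fix s assume "s \<in> S"
    then obtain v where v: "v \<in> carrier_vec k" "enorm v = 1" "s = v \<bullet> (K *\<^sub>v v)"
      unfolding S_def by blast
    have "- v \<bullet> (K *\<^sub>v v) \<le> enorm (- v) * enorm (K *\<^sub>v v)"
      using v K by (intro scalar_prod_le_enorm[of _ k]) auto
    moreover have "enorm (- v) = 1"
      using v by (simp add: enorm_eq_L2_set L2_set_def)
    ultimately show "- c \<le> s"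
      using v c(2)[OF v(1)] K by simp
  qed
  have ray: "\<mu> * (v \<bullet> v) \<le> v \<bullet> (K *\<^sub>v v)" if v: "v \<in> carrier_vec k" for v
  proof (cases "v = 0\<^sub>v k")
    case True
    then show ?thesis
      using K by simp
  next
    case False
    then have pos: "0 < enorm v"
      using enorm_pos v by blast
    let ?w = "(1 / enorm v) \<cdot>\<^sub>v v"
    have "?w \<bullet> (K *\<^sub>v ?w) \<in> S"
      unfolding S_def using v pos by (intro CollectI exI[of _ ?w]) (simp add: enorm_smult)
    then have "\<mu> \<le> ?w \<bullet> (K *\<^sub>v ?w)"
      unfolding \<mu>_def using bdd by (rule cInf_lower)
    also have "\<dots> = (v \<bullet> (K *\<^sub>v v)) / (enorm v)\<^sup>2"
      using v K by (simp add: mult_mat_vec[OF K v] power2_eq_square)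
    finally show ?thesis
      using pos by (simp add: enorm_sq[symmetric] field_simps)
  qed
  have "eigenvalue K \<mu>"
  proof (rule ccontr)
    assume not_ev: "\<not> eigenvalue K \<mu>"
    have "v = 0\<^sub>v k" if v: "v \<in> carrier_vec k" and "P *\<^sub>v v = 0\<^sub>v k" for v
    proof -
      have "K *\<^sub>v v = \<mu> \<cdot>\<^sub>v v"
        using that K Pv[OF v] by (intro eq_vecI) (auto simp: vec_eq_iff)
      then show ?thesis
        using not_ev v K unfolding eigenvalue_def eigenvector_def by auto
    qed
    then obtain W where W: "W \<in> carrier_mat k k" "W * P = 1\<^sub>m k"
      using inverse_of_injective_mat[OF P] by blast
    obtain p where p: "0 < p" "\<And>v. v \<in> carrier_vec k \<Longrightarrow> enorm (P *\<^sub>v v) \<le> p * enorm v"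
      using mult_mat_vec_bounded[OF P] by blast
    obtain w where w: "0 < w" "\<And>v. v \<in> carrier_vec k \<Longrightarrow> enorm (W *\<^sub>v v) \<le> w * enorm v"
      using mult_mat_vec_bounded[OF W(1)] by blast
    have "\<mu> + 1 / (w\<^sup>2 * p) \<le> s" if s: "s \<in> S" for s
    proof -
      obtain v where v: "v \<in> carrier_vec k" "enorm v = 1" "s = v \<bullet> (K *\<^sub>v v)"
        using s unfolding S_def by blast
      have "W *\<^sub>v (P *\<^sub>v v) = v"
        using W P v by (metis assoc_mult_mat_vec one_mult_mat_vec)
      then have "1 \<le> w * enorm (P *\<^sub>v v)"
        using w(2)[of "P *\<^sub>v v"] P v by auto
      then have "1\<^sup>2 \<le> (w * enorm (P *\<^sub>v v))\<^sup>2"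
        by (intro power_mono) auto
      also have "\<dots> \<le> w\<^sup>2 * (p * (v \<bullet> (P *\<^sub>v v)))"
        unfolding power_mult_distrib using psd_enorm_mult_le[OF P \<open>P\<^sup>T = P\<close> _ p v(1)] vPv ray
        by (intro mult_left_mono) auto
      also have "v \<bullet> (P *\<^sub>v v) = s - \<mu>"
        using vPv v by (simp flip: enorm_sq)
      finally show ?thesis
        using w p by (simp add: field_simps)
    qed
    then have "\<mu> + 1 / (w\<^sup>2 * p) \<le> \<mu>"
      unfolding \<mu>_def using ne by (intro cInf_greatest)
    moreover have "0 < 1 / (w\<^sup>2 * p)"
      using w p by simp
    ultimately show False
      by simp
  qed
  with ray show thesis
    using that by blast
qed

text \<open>For a wide matrix the singular values come from \<open>H H\<^sup>T\<close>, and the Rayleigh quotient of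
  \<open>H H\<^sup>T\<close> at \<open>v\<close> is \<open>\<parallel>H\<^sup>T v\<parallel>\<^sup>2 / \<parallel>v\<parallel>\<^sup>2\<close>. Positivity of \<open>sigma_min H\<close> serves to pass from
  \<open>sigma_min H \<le> sqrt \<mu>\<close> to squares.\<close>

lemma sigma_min_mult_le_enorm_transpose:
  assumes H: "H \<in> carrier_mat k l" and "k \<le> l" and pos: "0 < sigma_min H"
    and v: "v \<in> carrier_vec k"
  shows "sigma_min H * enorm v \<le> enorm (H\<^sup>T *\<^sub>v v)"
proof (cases "k = 0")
  case True
  then have "enorm v = 0"
    using v by (simp add: enorm_eq_L2_set)
  then show ?thesis
    by simp
next
  case False
  let ?K = "H * H\<^sup>T"
  have K: "?K \<in> carrier_mat k k" and sym: "?K\<^sup>T = ?K"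
    using H by (auto simp: transpose_mult)
  obtain \<mu> where \<mu>: "eigenvalue ?K \<mu>"
    and ray: "\<And>v. v \<in> carrier_vec k \<Longrightarrow> \<mu> * (v \<bullet> v) \<le> v \<bullet> (?K *\<^sub>v v)"
    using symmetric_rayleigh_eigenvalue[OF K sym] False by auto
  have sv: "singular_values H = sqrt ` spectrum ?K"
    using H \<open>k \<le> l\<close> by (simp add: singular_values_def spectrum_def)
  have "sigma_min H \<le> sqrt \<mu>"
    unfolding sigma_min_def sv using card_finite_spectrum(1)[OF K] \<mu>
    by (intro Min_le) (auto simp: spectrum_def)
  then have "(sigma_min H)\<^sup>2 \<le> \<mu>"
    using pos by (metis less_eq_real_def real_sqrt_le_iff real_sqrt_unique)
  then have "(sigma_min H)\<^sup>2 * (v \<bullet> v) \<le> \<mu> * (v \<bullet> v)"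
    by (intro mult_right_mono) (simp_all flip: enorm_sq)
  also have "\<dots> \<le> v \<bullet> (?K *\<^sub>v v)"
    by (rule ray[OF v])
  also have "\<dots> = (enorm (H\<^sup>T *\<^sub>v v))\<^sup>2"
    using transpose_vec_mult_scalar[of H k l "H\<^sup>T *\<^sub>v v" v] H v by (simp add: enorm_sq)
  finally have "(sigma_min H * enorm v)\<^sup>2 \<le> (enorm (H\<^sup>T *\<^sub>v v))\<^sup>2"
    by (simp add: power_mult_distrib enorm_sq)
  then show ?thesis
    by (rule power2_le_imp_le) simp
qed

section \<open>The pseudoinverse and minimum-norm solutions\<close>

text \<open>When the Gram matrix \<open>H H\<^sup>T\<close> is invertible, the four Penrose equations have the unique solution
  \<open>H\<^sup>T (H H\<^sup>T)\<^sup>-\<^sup>1\<close>. For uniqueness, a solution \<open>X\<close> is a right inverse of \<open>H\<close>, and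
  \<open>X = (X H)\<^sup>T X = H\<^sup>T (X\<^sup>T X)\<close>. Hence \<open>(H H\<^sup>T) (X\<^sup>T X) = I\<close>, which determines \<open>X\<^sup>T X\<close>.\<close>

lemma pinv_eq_transpose_mult_gram_inverse:
  assumes H: "H \<in> carrier_mat k l" and W: "W \<in> carrier_mat k k"
    and WK: "W * (H * H\<^sup>T) = 1\<^sub>m k" and KW: "H * H\<^sup>T * W = 1\<^sub>m k"
  shows "pinv H = H\<^sup>T * W"
  unfolding pinv_def
proof (rule the_equality)
  have Ht: "H\<^sup>T \<in> carrier_mat l k" and K: "H * H\<^sup>T \<in> carrier_mat k k"
    using H by auto
  have Wt: "W\<^sup>T \<in> carrier_mat k k"
    using W by auto
  let ?Y = "H\<^sup>T * W"
  have Y: "?Y \<in> carrier_mat l k"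
    using Ht W by auto
  have "(H * H\<^sup>T) * W\<^sup>T = (W * (H * H\<^sup>T))\<^sup>T"
    using H by (simp add: transpose_mult[OF W K] transpose_mult[OF H Ht])
  then have "(H * H\<^sup>T) * W\<^sup>T = 1\<^sub>m k"
    by (simp add: WK)
  then have W_sym: "W\<^sup>T = W"
    using assoc_mult_mat[OF W K Wt] W WK Wt by simp
  have HY: "H * ?Y = 1\<^sub>m k"
    using assoc_mult_mat[OF H Ht W] KW by simp
  have "(?Y * H)\<^sup>T = ?Y * H"
    unfolding transpose_mult[OF Y H] transpose_mult[OF Ht W] W_sym transpose_transpose
    using assoc_mult_mat[OF Ht W H] by simp
  moreover have "?Y * H * ?Y = ?Y"
    using assoc_mult_mat[OF Y H Y] HY right_mult_one_mat[OF Y] by simp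
  ultimately show "?Y \<in> carrier_mat (dim_col H) (dim_row H) \<and> H * ?Y * H = H \<and> ?Y * H * ?Y = ?Y
      \<and> (H * ?Y)\<^sup>T = H * ?Y \<and> (?Y * H)\<^sup>T = ?Y * H"
    using H Y HY by auto
  fix X
  assume X_penrose: "X \<in> carrier_mat (dim_col H) (dim_row H) \<and> H * X * H = H \<and> X * H * X = X
      \<and> (H * X)\<^sup>T = H * X \<and> (X * H)\<^sup>T = X * H"
  then have X: "X \<in> carrier_mat l k" and Xt: "X\<^sup>T \<in> carrier_mat k l"
    using H by auto
  have HX: "H * X \<in> carrier_mat k k"
    using H X by auto
  let ?Z = "X\<^sup>T * X"
  have Z: "?Z \<in> carrier_mat k k"
    using X by auto
  have "H * X = H * X * (H * ?Y)"
    unfolding HY by (rule right_mult_one_mat[OF HX, symmetric])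
  also have "\<dots> = H * X * H * ?Y"
    using assoc_mult_mat[OF HX H Y] by simp
  finally have HX1: "H * X = 1\<^sub>m k"
    using X_penrose HY by simp
  have "X = (X * H)\<^sup>T * X"
    using X_penrose by simp
  also have "\<dots> = H\<^sup>T * ?Z"
    using assoc_mult_mat[OF Ht Xt X] by (simp add: transpose_mult[OF X H])
  finally have XZ: "X = H\<^sup>T * ?Z" .
  then have "H * H\<^sup>T * ?Z = 1\<^sub>m k"
    using assoc_mult_mat[OF H Ht Z] HX1 by simp
  then have "?Z = W"
    using assoc_mult_mat[OF W K Z] WK left_mult_one_mat[OF Z] right_mult_one_mat[OF W] by simp
  then show "X = ?Y"
    using XZ by simp
qed

text \<open>A lower bound on \<open>H\<^sup>T\<close> makes \<open>H H\<^sup>T\<close> invertible. So \<open>pinv H b\<close> solves \<open>H g = b\<close> for every \<open>b\<close>,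
  and it lies in the row space of \<open>H\<close>, the orthogonal complement of the kernel. These two properties
  are all that the perturbation argument needs from the pseudoinverse.\<close>

lemma pinv_min_norm_solution:
  assumes H: "H \<in> carrier_mat k l" and "0 < s"
    and lower: "\<And>w. w \<in> carrier_vec k \<Longrightarrow> s * enorm w \<le> enorm (H\<^sup>T *\<^sub>v w)"
    and b: "b \<in> carrier_vec k"
  obtains z where "z \<in> carrier_vec k" "pinv H *\<^sub>v b = H\<^sup>T *\<^sub>v z" "H *\<^sub>v (H\<^sup>T *\<^sub>v z) = b"
proof -
  have Ht: "H\<^sup>T \<in> carrier_mat l k" and K: "H * H\<^sup>T \<in> carrier_mat k k"
    using H by auto
  have "w = 0\<^sub>v k" if w: "w \<in> carrier_vec k" and 0: "H * H\<^sup>T *\<^sub>v w = 0\<^sub>v k" for w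
  proof (rule ccontr)
    assume "w \<noteq> 0\<^sub>v k"
    then have "0 < s * enorm w"
      using enorm_pos[OF w] \<open>0 < s\<close> by simp
    then have "0 < enorm (H\<^sup>T *\<^sub>v w)"
      using lower[OF w] by simp
    moreover have "(enorm (H\<^sup>T *\<^sub>v w))\<^sup>2 = 0"
      using transpose_vec_mult_scalar[of H k l "H\<^sup>T *\<^sub>v w" w] H w 0 by (simp add: enorm_sq)
    ultimately show False
      by simp
  qed
  then obtain W where W: "W \<in> carrier_mat k k" "W * (H * H\<^sup>T) = 1\<^sub>m k" "H * H\<^sup>T * W = 1\<^sub>m k"
    using inverse_of_injective_mat[OF K] by blast
  have "pinv H *\<^sub>v b = H\<^sup>T *\<^sub>v (W *\<^sub>v b)"
    using pinv_eq_transpose_mult_gram_inverse[OF H W] assoc_mult_mat_vec[OF Ht W(1) b] by simp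
  moreover have Wb: "W *\<^sub>v b \<in> carrier_vec k"
    using W b by auto
  moreover have "H *\<^sub>v (H\<^sup>T *\<^sub>v (W *\<^sub>v b)) = b"
    using assoc_mult_mat_vec[OF H Ht Wb] assoc_mult_mat_vec[OF K W(1) b] W(3) b by simp
  ultimately show thesis
    using that by blast
qed

section \<open>Perturbation of minimum-norm solutions\<close>

lemma enorm_transpose_lower_perturbed:
  assumes H: "H \<in> carrier_mat k l" and H': "H' \<in> carrier_mat k l"
    and lower: "\<And>w. w \<in> carrier_vec k \<Longrightarrow> s * enorm w \<le> enorm (H\<^sup>T *\<^sub>v w)"
    and diff: "\<And>v. v \<in> carrier_vec l \<Longrightarrow> enorm ((H' - H) *\<^sub>v v) \<le> c * enorm v" and "0 \<le> c"
    and w: "w \<in> carrier_vec k"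
  shows "(s - c) * enorm w \<le> enorm (H'\<^sup>T *\<^sub>v w)"
proof -
  have E: "H' - H \<in> carrier_mat k l"
    using H H' by auto
  have "H\<^sup>T *\<^sub>v w = H'\<^sup>T *\<^sub>v w - (H' - H)\<^sup>T *\<^sub>v w"
  proof -
    have "(H' - H)\<^sup>T *\<^sub>v w = H'\<^sup>T *\<^sub>v w - H\<^sup>T *\<^sub>v w"
      using H H' w by (simp add: transpose_minus[of _ k l] minus_mult_distrib_mat_vec[of _ l k])
    then show ?thesis
      using H H' w by (intro eq_vecI) auto
  qed
  then have "enorm (H\<^sup>T *\<^sub>v w) \<le> enorm (H'\<^sup>T *\<^sub>v w) + enorm ((H' - H)\<^sup>T *\<^sub>v w)"
    using enorm_diff_le[of "H'\<^sup>T *\<^sub>v w" l "(H' - H)\<^sup>T *\<^sub>v w"] E H H' w by fastforce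
  then show ?thesis
    using lower[OF w] enorm_transpose_mult_le[OF E w diff \<open>0 \<le> c\<close>] by (simp add: algebra_simps)
qed

text \<open>The difference \<open>d = g' - g\<close> is split into a part \<open>d1\<close> in the row space of \<open>H'\<close> and a part \<open>d2\<close> in the
  kernel of \<open>H'\<close>.

  The row space part is governed by the residual \<open>H' d = (b' - b) - (H' - H) g\<close> and the lower bound
  \<open>s - c\<close> for \<open>H'\<^sup>T\<close>.

  The kernel part need not vanish, since \<open>g\<close> lies in the row space of \<open>H\<close> rather than of \<open>H'\<close>. However,
  \<open>g'\<close> is orthogonal to \<open>d2\<close>. Writing \<open>g = H\<^sup>T z\<close> gives \<open>\<parallel>d2\<parallel>\<^sup>2 = - (H d2 \<bullet> z) = (H' - H) d2 \<bullet> z\<close>,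
  and \<open>\<parallel>z\<parallel> \<le> \<parallel>g\<parallel> / s\<close>.\<close>

lemma min_norm_solution_perturbation:
  assumes H: "H \<in> carrier_mat k l" and H': "H' \<in> carrier_mat k l"
    and "0 < s" and "0 \<le> c" and "c < s"
    and lower: "\<And>w. w \<in> carrier_vec k \<Longrightarrow> s * enorm w \<le> enorm (H\<^sup>T *\<^sub>v w)"
    and diff: "\<And>v. v \<in> carrier_vec l \<Longrightarrow> enorm ((H' - H) *\<^sub>v v) \<le> c * enorm v"
    and b: "b \<in> carrier_vec k" and b': "b' \<in> carrier_vec k"
  defines "g \<equiv> pinv H *\<^sub>v b" and "g' \<equiv> pinv H' *\<^sub>v b'"
  shows "(enorm (g' - g))\<^sup>2
    \<le> ((enorm (b' - b) + c * enorm g) / (s - c))\<^sup>2 + (c * enorm g / s)\<^sup>2"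
proof -
  have E: "H' - H \<in> carrier_mat k l" and Ht: "H\<^sup>T \<in> carrier_mat l k" and Ht': "H'\<^sup>T \<in> carrier_mat l k"
    using H H' by auto
  have lower': "(s - c) * enorm w \<le> enorm (H'\<^sup>T *\<^sub>v w)" if "w \<in> carrier_vec k" for w
    using enorm_transpose_lower_perturbed[OF H H' lower diff \<open>0 \<le> c\<close> that] .
  have "0 < s - c"
    using \<open>c < s\<close> by simp
  have solution': "\<exists>z\<in>carrier_vec k. pinv H' *\<^sub>v f = H'\<^sup>T *\<^sub>v z \<and> H' *\<^sub>v (H'\<^sup>T *\<^sub>v z) = f"
    if "f \<in> carrier_vec k" for f
    using pinv_min_norm_solution[OF H' \<open>0 < s - c\<close> lower' that] by blast
  obtain z where z: "z \<in> carrier_vec k" "g = H\<^sup>T *\<^sub>v z" "H *\<^sub>v g = b"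
    using pinv_min_norm_solution[OF H \<open>0 < s\<close> lower b] unfolding g_def by metis
  obtain z' where z': "z' \<in> carrier_vec k" "g' = H'\<^sup>T *\<^sub>v z'" "H' *\<^sub>v g' = b'"
    using solution'[OF b'] unfolding g'_def by metis
  have g: "g \<in> carrier_vec l" and g': "g' \<in> carrier_vec l"
    using z z' H H' by auto
  define d where "d = g' - g"
  define r where "r = H' *\<^sub>v d"
  have d: "d \<in> carrier_vec l" and r: "r \<in> carrier_vec k"
    using g g' H' by (auto simp: d_def r_def)
  \<comment> \<open>\<open>d1\<close> is the orthogonal projection of \<open>d\<close> onto the row space of \<open>H'\<close>: the minimum-norm
    solution of \<open>H' v = H' d\<close>.\<close>
  obtain z1 where z1: "z1 \<in> carrier_vec k" "H' *\<^sub>v (H'\<^sup>T *\<^sub>v z1) = r"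
    using solution'[OF r] by metis
  define d1 where "d1 = H'\<^sup>T *\<^sub>v z1"
  define d2 where "d2 = d - d1"
  have d1: "d1 \<in> carrier_vec l" and d2: "d2 \<in> carrier_vec l"
    using d z1 H' by (auto simp: d1_def d2_def)
  have H'd2: "H' *\<^sub>v d2 = 0\<^sub>v k"
    using z1 r mult_minus_distrib_mat_vec[OF H' d d1] by (simp add: d1_def d2_def r_def)
  have orth: "(H'\<^sup>T *\<^sub>v w) \<bullet> d2 = 0" if "w \<in> carrier_vec k" for w
    using transpose_vec_mult_scalar[OF H' d2 that] H'd2 that Ht' d2
    by (simp add: comm_scalar_prod[of _ l])
  have d12: "d = d1 + d2"
    using d d1 by (auto simp: d2_def)
  have pythagoras: "(enorm d)\<^sup>2 = (enorm d1)\<^sup>2 + (enorm d2)\<^sup>2"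
    using orth[OF z1(1)] d1 d2 comm_scalar_prod[OF d2 d1]
    by (simp add: d12 enorm_sq add_scalar_prod_distrib[of _ l] scalar_prod_add_distrib[of _ l]
        flip: d1_def)
  have "enorm r \<le> enorm (b' - b) + c * enorm g"
  proof -
    have "r = (b' - b) - (H' - H) *\<^sub>v g"
      unfolding r_def d_def mult_minus_distrib_mat_vec[OF H' g' g]
        minus_mult_distrib_mat_vec[OF H' H g] z(3) z'(3)
      by (rule eq_vecI) (use b b' H' in auto)
    then show ?thesis
      using enorm_diff_le[of "b' - b" k "(H' - H) *\<^sub>v g"] diff[OF g] b b' E g by simp
  qed
  moreover have "(s - c) * enorm d1 \<le> enorm r"
  proof (cases "enorm d1 = 0")
    case False
    have "(enorm d1)\<^sup>2 = r \<bullet> z1"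
      unfolding enorm_sq using transpose_vec_mult_scalar[OF H' d1 z1(1)] z1 r d1 H'
      by (metis comm_scalar_prod d1_def mult_mat_vec_carrier)
    also have "\<dots> \<le> enorm r * enorm z1"
      by (rule scalar_prod_le_enorm[OF r z1(1)])
    finally have "(s - c) * (enorm d1)\<^sup>2 \<le> enorm r * ((s - c) * enorm z1)"
      using \<open>0 < s - c\<close> by (simp add: mult.left_commute)
    also have "\<dots> \<le> enorm r * enorm d1"
      using lower'[OF z1(1)] by (intro mult_left_mono) (auto simp: d1_def)
    finally have "enorm d1 * ((s - c) * enorm d1) \<le> enorm d1 * enorm r"
      by (simp add: power2_eq_square mult_ac)
    then show ?thesis
      using False enorm_nonneg[of d1] by (simp add: mult_le_cancel_left)
  qed simp
  ultimately have d1_le: "enorm d1 \<le> (enorm (b' - b) + c * enorm g) / (s - c)"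
    using \<open>0 < s - c\<close> by (simp add: field_simps)
  have "enorm d2 \<le> c * enorm g / s"
  proof (cases "enorm d2 = 0")
    case False
    have "(enorm d2)\<^sup>2 = d2 \<bullet> (g' - g)"
      using orth[OF z1(1)] comm_scalar_prod[OF d2 d1] d1 d2
      by (simp add: enorm_sq d12 scalar_prod_add_distrib[of _ l] flip: d_def d1_def)
    also have "\<dots> = - (d2 \<bullet> g)"
      using orth[OF z'(1)] comm_scalar_prod[OF d2 g'] d2 g g'
      by (simp add: scalar_prod_minus_distrib[of _ l] flip: z'(2))
    also have "\<dots> = (- (H *\<^sub>v d2)) \<bullet> z"
      using transpose_vec_mult_scalar[OF H d2 z(1)] comm_scalar_prod[OF d2 g] z(2) H z(1) d2
      by (simp add: comm_scalar_prod[of _ k])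
    also have "- (H *\<^sub>v d2) = (H' - H) *\<^sub>v d2"
      using H'd2 H d2 by (simp add: minus_mult_distrib_mat_vec[OF H' H d2])
    also have "((H' - H) *\<^sub>v d2) \<bullet> z \<le> enorm ((H' - H) *\<^sub>v d2) * enorm z"
      using E d2 z by (intro scalar_prod_le_enorm) auto
    also have "\<dots> \<le> (c * enorm d2) * enorm z"
      by (intro mult_right_mono diff d2) simp
    finally have "enorm d2 * enorm d2 \<le> enorm d2 * (c * enorm z)"
      by (simp add: power2_eq_square mult_ac)
    then have "enorm d2 \<le> c * enorm z"
      using False enorm_nonneg[of d2] by (simp add: mult_le_cancel_left)
    also have "\<dots> \<le> c * (enorm g / s)"
      using lower[OF z(1)] \<open>0 < s\<close> \<open>0 \<le> c\<close> by (intro mult_left_mono) (auto simp: z(2) field_simps)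
    finally show ?thesis
      by simp
  qed (use \<open>0 < s\<close> \<open>0 \<le> c\<close> in simp)
  then have "(enorm d2)\<^sup>2 \<le> (c * enorm g / s)\<^sup>2"
    by (intro power_mono) auto
  moreover have "(enorm d1)\<^sup>2 \<le> ((enorm (b' - b) + c * enorm g) / (s - c))\<^sup>2"
    using d1_le by (intro power_mono) auto
  ultimately show ?thesis
    using pythagoras by (simp add: d_def)
qed

section \<open>Page matrices\<close>

lemma first_rows_carrier:
  "M \<in> carrier_mat r c \<Longrightarrow> k \<le> r \<Longrightarrow> first_rows k M \<in> carrier_mat k c"
  unfolding first_rows_def by (rule carrier_matI) simp_all

lemma last_rows_carrier:
  "M \<in> carrier_mat r c \<Longrightarrow> k \<le> r \<Longrightarrow> last_rows k M \<in> carrier_mat k c"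
  unfolding last_rows_def by (rule carrier_matI) simp_all

lemma page_matrix_carrier: "page_matrix d L v a b \<in> carrier_mat (d * L) ((b + 1 - a) div L)"
  unfolding page_matrix_def by (rule carrier_matI) simp_all

lemma vstack_carrier:
  "(\<And>M. M \<in> set Ms \<Longrightarrow> M \<in> carrier_mat r c) \<Longrightarrow> vstack c Ms \<in> carrier_mat (length Ms * r) c"
proof (induction Ms)
  case (Cons M Ms)
  then have "M @\<^sub>r vstack c Ms \<in> carrier_mat (r + length Ms * r) c"
    by (intro carrier_append_rows) simp_all
  then show ?case
    by (simp add: vstack_def)
qed (simp add: vstack_def)

lemma full_row_rank_imp_dim_le:
  assumes "full_row_rank M"
  shows "dim_row M \<le> dim_col M"
  using vec_space.rank_le_nc[of M "dim_row M" "dim_col M"] assms by (simp add: full_row_rank_def)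

text \<open>A matrix of full row rank is at least as wide as it is high. The stacked page matrices have \<open>k d L\<close>
  rows and at most \<open>T div L\<close> columns.\<close>

lemma page_exciting_imp_le:
  assumes "page_exciting d L T v k"
  shows "k * (d * L) \<le> T div L"
proof -
  let ?Ms = "map (\<lambda>i. page_matrix d L v (i * L + 1) (T - (k - 1 - i) * L)) [0..<k]"
  let ?c = "(T - (k - 1) * L) div L"
  have "page_matrix d L v (i * L + 1) (T - (k - 1 - i) * L) \<in> carrier_mat (d * L) ?c"
    if "i < k" for i
  proof -
    have "(k - 1 - i) * L + i * L = (k - 1) * L"
      using that by (simp flip: distrib_right)
    then have "T - (k - 1 - i) * L + 1 - (i * L + 1) = T - (k - 1) * L"
      by simp
    then show ?thesis
      using page_matrix_carrier[of d L v "i * L + 1" "T - (k - 1 - i) * L"] by simp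
  qed
  then have "vstack ?c ?Ms \<in> carrier_mat (length ?Ms * (d * L)) ?c"
    by (intro vstack_carrier) auto
  then have "k * (d * L) \<le> ?c"
    using assms full_row_rank_imp_dim_le[of "vstack ?c ?Ms"] by (simp add: page_exciting_def)
  also have "?c \<le> T div L"
    by (simp add: div_le_mono)
  finally show ?thesis .
qed

lemma entry_le_mat_max_norm:
  assumes "M \<in> carrier_mat k l" "i < k" "j < l"
  shows "\<bar>M $$ (i, j)\<bar> \<le> mat_max_norm M"
  unfolding mat_max_norm_def
  by (intro Max_ge imageI elements_matI[OF assms refl]) (simp add: elements_mat_def)

lemma entry_le_vec_max_norm:
  assumes "v \<in> carrier_vec k" "i < k"
  shows "\<bar>v $ i\<bar> \<le> vec_max_norm v"
  unfolding vec_max_norm_def using assms by (intro Max_ge) auto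

section \<open>The error bounds\<close>

text \<open>This merges the two orthogonal error parts into one gain. In the application \<open>p\<close> is the length of the past
  window, \<open>h\<close> the number of columns and \<open>\<gamma> = \<parallel>g\<parallel>\<close>. The perturbation of the data matrix is only
  \<open>c = sqrt (p h) \<delta>\<close>, because the noise enters \<open>p\<close> of its rows, whereas the gain has room for \<open>h \<delta>\<close>. The
  surplus absorbs the kernel part, which contributes a quarter of \<open>(sqrt (p h) \<gamma>)\<^sup>2\<close> in units of
  \<open>(2 \<delta> / s)\<^sup>2\<close>. This is where \<open>5 / 4 p \<le> h\<close> comes from.\<close>

lemma gain_inequality:
  fixes p h \<gamma> \<delta> s c e :: real
  assumes "0 \<le> p" "5 / 4 * p \<le> h" "0 \<le> \<gamma>" "0 \<le> \<delta>" "0 < s" "c \<le> s / 2"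
    and c: "c = sqrt (p * h) * \<delta>" and e: "0 \<le> e" "e \<le> sqrt p * \<delta>"
  shows "((e + c * \<gamma>) / (s - c))\<^sup>2 + (c * \<gamma> / s)\<^sup>2
    \<le> (2 * inverse s * (sqrt p + h * \<gamma>) * \<delta>)\<^sup>2"
proof -
  define q where "q = sqrt (p * h)"
  have h: "0 \<le> h" "p \<le> h"
    using assms by auto
  have q: "0 \<le> q" "q\<^sup>2 = p * h"
    using h assms by (auto simp: q_def)
  have cq: "c = q * \<delta>" "0 \<le> c"
    using c q assms by (auto simp: q_def)
  have qh: "5 / 4 * q\<^sup>2 \<le> h\<^sup>2"
    using mult_right_mono[OF assms(2) h(1)] by (simp only: q) (simp add: power2_eq_square)
  then have "q\<^sup>2 \<le> h\<^sup>2"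
    using zero_le_power2[of q] by linarith
  then have "q \<le> h"
    using h(1) by (rule power2_le_imp_le)
  have "(e + c * \<gamma>) / (s - c) \<le> (sqrt p * \<delta> + c * \<gamma>) / (s / 2)"
    using assms cq by (intro frac_le) auto
  also have "\<dots> = 2 * \<delta> / s * (sqrt p + q * \<gamma>)"
    by (simp add: cq field_simps)
  finally have "((e + c * \<gamma>) / (s - c))\<^sup>2 \<le> (2 * \<delta> / s * (sqrt p + q * \<gamma>))\<^sup>2"
    using assms cq by (intro power_mono) auto
  moreover have "(c * \<gamma> / s)\<^sup>2 = (2 * \<delta> / s)\<^sup>2 * (q * \<gamma> / 2)\<^sup>2"
    by (simp add: cq power_mult_distrib power_divide)
  ultimately have "((e + c * \<gamma>) / (s - c))\<^sup>2 + (c * \<gamma> / s)\<^sup>2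
      \<le> (2 * \<delta> / s)\<^sup>2 * ((sqrt p + q * \<gamma>)\<^sup>2 + (q * \<gamma> / 2)\<^sup>2)"
    by (metis add_mono_thms_linordered_semiring(3) distrib_left power_mult_distrib)
  also have "(sqrt p + q * \<gamma>)\<^sup>2 + (q * \<gamma> / 2)\<^sup>2
      = (sqrt p)\<^sup>2 + 2 * (sqrt p * (q * \<gamma>)) + 5 / 4 * q\<^sup>2 * \<gamma>\<^sup>2"
    by (simp add: power2_eq_square algebra_simps)
  also have "\<dots> \<le> (sqrt p)\<^sup>2 + 2 * (sqrt p * (h * \<gamma>)) + h\<^sup>2 * \<gamma>\<^sup>2"
    using \<open>q \<le> h\<close> qh assms by (intro add_mono mult_left_mono mult_right_mono) auto
  also have "\<dots> = (sqrt p + h * \<gamma>)\<^sup>2"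
    by (simp add: power2_eq_square algebra_simps)
  also have "(2 * \<delta> / s)\<^sup>2 * \<dots> = (2 * inverse s * (sqrt p + h * \<gamma>) * \<delta>)\<^sup>2"
    unfolding power_mult_distrib[symmetric] by (simp add: field_simps)
  finally show ?thesis
    by (simp add: mult_left_mono)
qed

lemma append_vec_diff_middle:
  fixes a b' b c :: rvec
  assumes "a \<in> carrier_vec j" "b \<in> carrier_vec k" "b' \<in> carrier_vec k" "c \<in> carrier_vec l"
  shows "(a @\<^sub>v b' @\<^sub>v c) - (a @\<^sub>v b @\<^sub>v c) = 0\<^sub>v j @\<^sub>v (b' - b) @\<^sub>v 0\<^sub>v l"
  using assms by (intro eq_vecI) (auto simp: append_vec_def)

(* In the last summand of the output error bound, gain is multiplied by delta, since gain * delta is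
   what bounds enorm (gb - gh).  With gain alone the bound does not scale when data and noise are
   multiplied by a common factor, and it fails for large delta; for delta <= 1 it does hold, and that
   version is the third conclusion. *)

theorem theorem10:
  fixes A B C D :: rmat
    and n m L T l\<^sub>o l\<^sub>p l\<^sub>f l\<^sub>h :: nat
    and M :: "'w measure" and Q :: "(nat \<Rightarrow> real) measure" and u :: "'w \<Rightarrow> nat \<Rightarrow> rvec" and \<omega> :: 'w
    and x y yh xr ur yr :: "nat \<Rightarrow> rvec"
    and Up Uf Yp Yf Yph Yfh Hh Hb :: rmat
    and up yp yph u\<^sub>f bh bb gh gb yfh yfb :: rvec
    and gain \<delta> :: real
  assumes "l\<^sub>o = observability_index A C"
    and "l\<^sub>p = l\<^sub>o"
    and "l\<^sub>f = L - l\<^sub>p"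
    and "l\<^sub>h = T div L"
    and "Up = first_rows (m * l\<^sub>p) (page_matrix m L (u \<omega>) 1 T)"
    and "Uf = last_rows (m * l\<^sub>f) (page_matrix m L (u \<omega>) 1 T)"
    and "Yp = first_rows l\<^sub>p (page_matrix 1 L y 1 T)"
    and "Yf = last_rows l\<^sub>f (page_matrix 1 L y 1 T)"
    and "Yph = first_rows l\<^sub>p (page_matrix 1 L yh 1 T)"
    and "Yfh = last_rows l\<^sub>f (page_matrix 1 L yh 1 T)"
    and "up = col_seq m ur 1 l\<^sub>p"
    and "yp = col_seq 1 yr 1 l\<^sub>p"
    and "Hh = Up @\<^sub>r Yph @\<^sub>r Uf"
    and "bh = up @\<^sub>v yph @\<^sub>v u\<^sub>f"
    and "gh = pinv Hh *\<^sub>v bh"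
    and "yfh = Yfh *\<^sub>v gh"
    and "Hb = Up @\<^sub>r Yp @\<^sub>r Uf"
    and "bb = up @\<^sub>v yp @\<^sub>v u\<^sub>f"
    and "gb = pinv Hb *\<^sub>v bb"
    and "yfb = Yf *\<^sub>v gb"
    and "gain = 2 * inverse (sigma_min Hh) * (sqrt (real l\<^sub>p) + real l\<^sub>h * enorm gh)"
    and "0 < n"
    and "A \<in> carrier_mat n n" and "B \<in> carrier_mat n m"
    and "C \<in> carrier_mat 1 n" and "D \<in> carrier_mat 1 m"
    and "controllable A B C D" and "observable A B C D"
    and "l\<^sub>o < L" and "4 * L\<^sup>2 + L \<le> T"
    and "prob_space M"
    and "\<And>w t. w \<in> space M \<Longrightarrow> t \<in> {1..T} \<Longrightarrow> u w t \<in> carrier_vec m"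
    and "sets Q = sets (PiM {..<m * L} (\<lambda>_. borel))"
    and "null_on_proper_subspaces (m * L) Q"
    and "iid_input_blocks M Q m L (4 * L + 1) u"
    and "\<omega> \<in> space M"
    and "page_exciting m L T (u \<omega>) (n + 1)"
    and "lti_trajectory A B C D T x (u \<omega>) y" and "x 1 = 0\<^sub>v n"
    and "\<And>t. t \<in> {1..T} \<Longrightarrow> yh t \<in> carrier_vec 1"
    and "lti_trajectory A B C D l\<^sub>p xr ur yr"
    and "yph \<in> carrier_vec l\<^sub>p"
    and "0 < \<delta>"
    and "Max {mat_max_norm (Yph - Yp), mat_max_norm (Yfh - Yf), vec_max_norm (yph - yp)} \<le> \<delta>"
    and "\<delta> < sigma_min Hh / (2 * real l\<^sub>h)"
    and "u\<^sub>f \<in> carrier_vec (m * l\<^sub>f)"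
  shows "enorm (gb - gh) \<le> gain * \<delta>
    \<and> enorm (yfb - yfh) \<le>
          gain * spectral_norm Yfh * \<delta> + real l\<^sub>h * (enorm gh + gain * \<delta>) * \<delta>
    \<and> (\<delta> \<le> 1 \<longrightarrow>
          enorm (yfb - yfh) \<le>
            gain * spectral_norm Yfh * \<delta> + real l\<^sub>h * (enorm gh + gain) * \<delta>)"
proof -
  define k where "k = m * l\<^sub>p + (l\<^sub>p + m * l\<^sub>f)"
  define s where "s = sigma_min Hh"
  define c where "c = sqrt (real l\<^sub>p * real l\<^sub>h) * \<delta>"
  have lp: "l\<^sub>p < L" and "l\<^sub>f \<le> L" and "0 < L" and mL: "m * l\<^sub>p + m * l\<^sub>f = m * L"
    using \<open>l\<^sub>o < L\<close> \<open>l\<^sub>p = l\<^sub>o\<close> \<open>l\<^sub>f = L - l\<^sub>p\<close> by (auto simp flip: distrib_left)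
  have "(4 * L\<^sup>2 + L) div L = 4 * L + 1"
    using \<open>0 < L\<close> by (simp add: power2_eq_square)
  then have lh: "4 * L + 1 \<le> l\<^sub>h"
    using div_le_mono[OF \<open>4 * L\<^sup>2 + L \<le> T\<close>, of L] \<open>l\<^sub>h = T div L\<close> by simp

  have U: "page_matrix m L (u \<omega>) 1 T \<in> carrier_mat (m * L) l\<^sub>h"
    and Y: "page_matrix 1 L y 1 T \<in> carrier_mat L l\<^sub>h"
    and Yh: "page_matrix 1 L yh 1 T \<in> carrier_mat L l\<^sub>h"
    using page_matrix_carrier[of m L "u \<omega>" 1 T] page_matrix_carrier[of 1 L y 1 T]
      page_matrix_carrier[of 1 L yh 1 T] \<open>l\<^sub>h = T div L\<close> by auto
  have le: "m * l\<^sub>p \<le> m * L" "m * l\<^sub>f \<le> m * L" "l\<^sub>p \<le> L"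
    using lp \<open>l\<^sub>f \<le> L\<close> by simp_all
  have Up: "Up \<in> carrier_mat (m * l\<^sub>p) l\<^sub>h" and Uf: "Uf \<in> carrier_mat (m * l\<^sub>f) l\<^sub>h"
    and Yp: "Yp \<in> carrier_mat l\<^sub>p l\<^sub>h" and Yph: "Yph \<in> carrier_mat l\<^sub>p l\<^sub>h"
    and Yf: "Yf \<in> carrier_mat l\<^sub>f l\<^sub>h" and Yfh: "Yfh \<in> carrier_mat l\<^sub>f l\<^sub>h"
    unfolding assms(5-10)
    by (fact first_rows_carrier[OF U le(1)] last_rows_carrier[OF U le(2)]
        first_rows_carrier[OF Y le(3)] last_rows_carrier[OF Y \<open>l\<^sub>f \<le> L\<close>]
        first_rows_carrier[OF Yh le(3)] last_rows_carrier[OF Yh \<open>l\<^sub>f \<le> L\<close>])+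
  have Hh: "Hh \<in> carrier_mat k l\<^sub>h" and Hb: "Hb \<in> carrier_mat k l\<^sub>h"
    unfolding \<open>Hh = Up @\<^sub>r Yph @\<^sub>r Uf\<close> \<open>Hb = Up @\<^sub>r Yp @\<^sub>r Uf\<close> k_def
    by (fact carrier_append_rows[OF Up carrier_append_rows[OF Yph Uf]]
        carrier_append_rows[OF Up carrier_append_rows[OF Yp Uf]])+
  have up: "up \<in> carrier_vec (m * l\<^sub>p)" and yp: "yp \<in> carrier_vec l\<^sub>p"
    unfolding \<open>up = col_seq m ur 1 l\<^sub>p\<close> \<open>yp = col_seq 1 yr 1 l\<^sub>p\<close> col_seq_def
    by (rule carrier_vecI, simp)+
  note yph = \<open>yph \<in> carrier_vec l\<^sub>p\<close> and uf = \<open>u\<^sub>f \<in> carrier_vec (m * l\<^sub>f)\<close>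
  have bh: "bh \<in> carrier_vec k" and bb: "bb \<in> carrier_vec k"
    unfolding \<open>bh = up @\<^sub>v yph @\<^sub>v u\<^sub>f\<close> \<open>bb = up @\<^sub>v yp @\<^sub>v u\<^sub>f\<close> k_def
    by (fact append_carrier_vec[OF up append_carrier_vec[OF yph uf]]
        append_carrier_vec[OF up append_carrier_vec[OF yp uf]])+

  \<comment> \<open>The data matrices are wide, so \<open>sigma_min Hh\<close> is taken from \<open>Hh Hh\<^sup>T\<close>. Excitation of order
    \<open>n + 1 \<ge> 2\<close> yields at least \<open>2 m L\<close> columns, and \<open>m L + l\<^sub>p \<le> 2 m L\<close> if there are inputs at all.
    Without inputs, only the \<open>l\<^sub>p < L\<close> rows of past outputs remain.\<close>
  have "k \<le> l\<^sub>h"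
  proof (cases "m = 0")
    case True
    then show ?thesis
      using lp lh by (simp add: k_def)
  next
    case False
    then have "L \<le> m * L"
      by simp
    then have "k \<le> 2 * (m * L)"
      using lp mL unfolding k_def by linarith
    also have "\<dots> \<le> (n + 1) * (m * L)"
      using \<open>0 < n\<close> by (intro mult_right_mono) auto
    also have "\<dots> \<le> l\<^sub>h"
      using page_exciting_imp_le[OF \<open>page_exciting m L T (u \<omega>) (n + 1)\<close>] \<open>l\<^sub>h = T div L\<close> by simp
    finally show ?thesis .
  qed

  have noise: "mat_max_norm (Yph - Yp) \<le> \<delta>" "mat_max_norm (Yfh - Yf) \<le> \<delta>"
      "vec_max_norm (yph - yp) \<le> \<delta>"
    using \<open>Max {mat_max_norm (Yph - Yp), mat_max_norm (Yfh - Yf), vec_max_norm (yph - yp)} \<le> \<delta>\<close>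
    by simp_all
  have Yp_entries: "\<bar>(Yp - Yph) $$ (i, j)\<bar> \<le> \<delta>" if "i < l\<^sub>p" "j < l\<^sub>h" for i j
    using entry_le_mat_max_norm[OF minus_carrier_mat[OF Yp, of Yph] that] noise(1) that Yp Yph
    by (simp add: abs_minus_commute)
  have Yf_entries: "\<bar>(Yf - Yfh) $$ (i, j)\<bar> \<le> \<delta>" if "i < l\<^sub>f" "j < l\<^sub>h" for i j
    using entry_le_mat_max_norm[OF minus_carrier_mat[OF Yf, of Yfh] that] noise(2) that Yf Yfh
    by (simp add: abs_minus_commute)
  have yp_entries: "\<bar>(yp - yph) $ i\<bar> \<le> \<delta>" if "i < l\<^sub>p" for i
    using entry_le_vec_max_norm[OF minus_carrier_vec[OF yph yp] that] noise(3) that yp yph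
    by (simp add: abs_minus_commute)

  have diff_H: "enorm ((Hb - Hh) *\<^sub>v v) \<le> c * enorm v" if v: "v \<in> carrier_vec l\<^sub>h" for v
  proof -
    have "(Hb - Hh) *\<^sub>v v = Hb *\<^sub>v v - Hh *\<^sub>v v"
      by (rule minus_mult_distrib_mat_vec[OF Hb Hh v])
    also have "\<dots> = 0\<^sub>v (m * l\<^sub>p) @\<^sub>v (Yp *\<^sub>v v - Yph *\<^sub>v v) @\<^sub>v 0\<^sub>v (m * l\<^sub>f)"
      unfolding \<open>Hh = Up @\<^sub>r Yph @\<^sub>r Uf\<close> \<open>Hb = Up @\<^sub>r Yp @\<^sub>r Uf\<close>
        mat_mult_append[OF Up carrier_append_rows[OF Yp Uf] v] mat_mult_append[OF Yp Uf v]
        mat_mult_append[OF Up carrier_append_rows[OF Yph Uf] v] mat_mult_append[OF Yph Uf v]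
      by (rule append_vec_diff_middle) (rule mult_mat_vec_carrier[OF _ v], fact)+
    also have "Yp *\<^sub>v v - Yph *\<^sub>v v = (Yp - Yph) *\<^sub>v v"
      by (rule minus_mult_distrib_mat_vec[OF Yp Yph v, symmetric])
    finally have "(Hb - Hh) *\<^sub>v v = 0\<^sub>v (m * l\<^sub>p) @\<^sub>v ((Yp - Yph) *\<^sub>v v) @\<^sub>v 0\<^sub>v (m * l\<^sub>f)" .
    moreover have "(Yp - Yph) *\<^sub>v v \<in> carrier_vec l\<^sub>p"
      by (rule mult_mat_vec_carrier[OF minus_carrier_mat[OF Yph] v])
    ultimately have "enorm ((Hb - Hh) *\<^sub>v v) = enorm ((Yp - Yph) *\<^sub>v v)"
      by (simp add: enorm_append_zero)
    also have "\<dots> \<le> c * enorm v"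
      unfolding c_def using Yp_entries \<open>0 < \<delta>\<close> Yp Yph
      by (intro enorm_mult_mat_vec_le_entries[OF _ v]) auto
    finally show ?thesis .
  qed
  have diff_b: "enorm (bb - bh) \<le> sqrt (real l\<^sub>p) * \<delta>"
  proof -
    have "bb - bh = 0\<^sub>v (m * l\<^sub>p) @\<^sub>v (yp - yph) @\<^sub>v 0\<^sub>v (m * l\<^sub>f)"
      unfolding \<open>bh = up @\<^sub>v yph @\<^sub>v u\<^sub>f\<close> \<open>bb = up @\<^sub>v yp @\<^sub>v u\<^sub>f\<close>
      by (rule append_vec_diff_middle[OF up yph yp uf])
    moreover have ypd: "yp - yph \<in> carrier_vec l\<^sub>p"
      using yp yph by auto
    ultimately have "enorm (bb - bh) = enorm (yp - yph)"
      by (simp add: enorm_append_zero)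
    also have "\<dots> \<le> sqrt (real l\<^sub>p) * \<delta>"
      using yp_entries \<open>0 < \<delta>\<close> by (intro enorm_le_entries[OF ypd]) auto
    finally show ?thesis .
  qed

  have sqrt_le_lh: "sqrt (real a * real l\<^sub>h) \<le> real l\<^sub>h" if "a \<le> L" for a
    using that lh by (intro real_le_lsqrt) (auto simp: power2_eq_square intro!: mult_right_mono)
  have "real l\<^sub>h * \<delta> < s / 2"
    using \<open>\<delta> < sigma_min Hh / (2 * real l\<^sub>h)\<close> lh by (simp add: s_def field_simps)
  moreover have "0 \<le> c" "c \<le> real l\<^sub>h * \<delta>"
    unfolding c_def using \<open>0 < \<delta>\<close> sqrt_le_lh[of l\<^sub>p] lp by (auto intro!: mult_right_mono)
  ultimately have "c \<le> s / 2" "0 < s" "c < s"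
    by linarith+
  have lower: "s * enorm w \<le> enorm (Hh\<^sup>T *\<^sub>v w)" if "w \<in> carrier_vec k" for w
    using sigma_min_mult_le_enorm_transpose[OF Hh \<open>k \<le> l\<^sub>h\<close> _ that] \<open>0 < s\<close> by (simp add: s_def)

  have gh: "gh \<in> carrier_vec l\<^sub>h" and gb: "gb \<in> carrier_vec l\<^sub>h"
  proof -
    obtain z where "z \<in> carrier_vec k" "gh = Hh\<^sup>T *\<^sub>v z"
      using pinv_min_norm_solution[OF Hh \<open>0 < s\<close> lower bh] \<open>gh = pinv Hh *\<^sub>v bh\<close> by metis
    then show "gh \<in> carrier_vec l\<^sub>h"
      using Hh by auto
    have "0 < s - c"
      using \<open>c < s\<close> by simp
    moreover have "(s - c) * enorm w \<le> enorm (Hb\<^sup>T *\<^sub>v w)" if "w \<in> carrier_vec k" for w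
      using enorm_transpose_lower_perturbed[OF Hh Hb lower diff_H \<open>0 \<le> c\<close> that] .
    ultimately obtain z' where "z' \<in> carrier_vec k" "gb = Hb\<^sup>T *\<^sub>v z'"
      using pinv_min_norm_solution[OF Hb _ _ bb] \<open>gb = pinv Hb *\<^sub>v bb\<close> by metis
    then show "gb \<in> carrier_vec l\<^sub>h"
      using Hb by auto
  qed

  have "0 \<le> gain"
    using \<open>0 < s\<close> by (simp add: \<open>gain = _\<close> s_def)
  have "(enorm (gb - gh))\<^sup>2
      \<le> ((enorm (bb - bh) + c * enorm gh) / (s - c))\<^sup>2 + (c * enorm gh / s)\<^sup>2"
    using min_norm_solution_perturbation[OF Hh Hb \<open>0 < s\<close> \<open>0 \<le> c\<close> \<open>c < s\<close> lower diff_H bh bb]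
    unfolding \<open>gh = pinv Hh *\<^sub>v bh\<close> \<open>gb = pinv Hb *\<^sub>v bb\<close> .
  also have "\<dots> \<le> (gain * \<delta>)\<^sup>2"
    unfolding \<open>gain = _\<close> s_def[symmetric]
    using lp lh \<open>0 < \<delta>\<close> \<open>0 < s\<close> \<open>c \<le> s / 2\<close> diff_b
    by (intro gain_inequality) (auto simp: c_def)
  finally have g_bound: "enorm (gb - gh) \<le> gain * \<delta>"
    using \<open>0 \<le> gain\<close> \<open>0 < \<delta>\<close> by (intro power2_le_imp_le[of "enorm (gb - gh)"]) auto

  have gd: "gb - gh \<in> carrier_vec l\<^sub>h"
    using gb gh by simp
  have "yfb - yfh = Yfh *\<^sub>v (gb - gh) + (Yf - Yfh) *\<^sub>v gb"
    unfolding \<open>yfh = Yfh *\<^sub>v gh\<close> \<open>yfb = Yf *\<^sub>v gb\<close> mult_minus_distrib_mat_vec[OF Yfh gb gh]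
      minus_mult_distrib_mat_vec[OF Yf Yfh gb]
    by (rule eq_vecI) (use Yf Yfh gb gh in auto)
  then have split: "enorm (yfb - yfh) \<le> enorm (Yfh *\<^sub>v (gb - gh)) + enorm ((Yf - Yfh) *\<^sub>v gb)"
    using enorm_add_le[OF mult_mat_vec_carrier[OF Yfh gd]
        mult_mat_vec_carrier[OF minus_carrier_mat[OF Yfh] gb]] by simp
  have Yfh_part: "enorm (Yfh *\<^sub>v (gb - gh)) \<le> spectral_norm Yfh * (gain * \<delta>)"
    using enorm_mult_mat_vec_le_spectral_norm[OF Yfh gd] g_bound spectral_norm_nonneg[of Yfh]
    by (meson mult_left_mono order.trans)
  have Yf_part: "enorm ((Yf - Yfh) *\<^sub>v gb) \<le> real l\<^sub>h * (enorm gh + gain * \<delta>) * \<delta>"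
  proof -
    have "enorm ((Yf - Yfh) *\<^sub>v gb) \<le> sqrt (real l\<^sub>f * real l\<^sub>h) * \<delta> * enorm gb"
      using Yf_entries \<open>0 < \<delta>\<close> Yf Yfh
      by (intro enorm_mult_mat_vec_le_entries[OF _ gb]) auto
    also have "\<dots> \<le> real l\<^sub>h * \<delta> * enorm gb"
      using sqrt_le_lh[OF \<open>l\<^sub>f \<le> L\<close>] \<open>0 < \<delta>\<close> by (intro mult_right_mono) auto
    also have "\<dots> \<le> real l\<^sub>h * \<delta> * (enorm gh + gain * \<delta>)"
    proof (rule mult_left_mono)
      have "gb = gh + (gb - gh)"
        using gb gh by auto
      then show "enorm gb \<le> enorm gh + gain * \<delta>"
        using enorm_add_le[OF gh gd] g_bound by simp
    qed (use \<open>0 < \<delta>\<close> in simp)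
    finally show ?thesis
      by (simp only: mult_ac)
  qed
  have y_bound: "enorm (yfb - yfh) \<le>
      gain * spectral_norm Yfh * \<delta> + real l\<^sub>h * (enorm gh + gain * \<delta>) * \<delta>"
    using split Yfh_part Yf_part by (simp add: mult_ac)
  have "real l\<^sub>h * (enorm gh + gain * \<delta>) * \<delta> \<le> real l\<^sub>h * (enorm gh + gain) * \<delta>" if "\<delta> \<le> 1"
    using that \<open>0 \<le> gain\<close> \<open>0 < \<delta>\<close>
    by (intro mult_right_mono mult_left_mono add_left_mono mult_right_le_one_le) auto
  then show ?thesis
    using g_bound y_bound by auto
qed

end
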